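(* Let $A$ be a finite-dimensional evolution algebra over a field $\mathbb{K}$ and $S$ a subset of $A$. (1) Suppose $S$ is a cut of over unicity for $A$. Then for every pair of different evolution ideals $I,J$ of $A$ containing $S$ such that there exists an evolution ideal $R$ of $A$ with $S\subseteq R\subseteq I\cap J$, there exists exactly one evolution ideal $T$ of $A$ with $T\in\operatorname{MinEvid}(I\cup J)$. Moreover, among the evolution ideals $R$ with $S\subseteq R\subseteq I\cap J$ there exists a maximal one and it is unique. (2) Suppose $S$ is a cut of below unicity for $A$. Then for every pair of different evolution ideals $I,J$ of $A$ contained in $S$ such that there exists an evolution ideal $R$ of $A$ with $S\supseteq R\supseteq I\cup J$, there exists exactly one evolution ideal $T$ of $A$ with $T\in\operatorname{MaxEvid}(I\cap J)$. Moreover, among the evolution ideals $R$ with $S\supseteq R\supseteq I\cup J$ there exists a maximal one and it is unique.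
   Context: An algebra over a field $\mathbb{K}$ is a $\mathbb{K}$-vector space with a bilinear multiplication (not necessarily associative). "Ideal" means two-sided ideal. A natural basis of an algebra is a vector space basis $\{e_i\}$ with $e_ie_j=0$ for $i\neq j$; an evolution algebra is an algebra having a natural basis. An evolution ideal of $A$ is an ideal of $A$ which, as an algebra, has a natural basis; $\{0\}$ is an evolution ideal (with empty natural basis). For $T\subseteq A$, $\operatorname{MinEvid}(T)$ is the set of evolution ideals of $A$ that are minimal (for inclusion) among the evolution ideals of $A$ containing $T$, and $\operatorname{MaxEvid}(T)$ is the set of evolution ideals of $A$ that are maximal among the evolution ideals of $A$ contained in $T$. $\operatorname{Evido}(S)$ is the set of all evolution ideals of $A$ containing $S$; $\operatorname{Evidb}(S)$ is the set of all evolution ideals of $A$ contained in $S$. A lattice definable over $S$ is a triple $(H,f',g')$ where $H\subseteq\operatorname{Evido}(S)$ is ordered by inclusion and $f',g'$ are maps from the set of two-element subsets of $H$ to $H$ such that for all distinct $X,Y\in H$: $f'(\{X,Y\})\in\operatorname{MaxEvid}(X\cap Y)$, $g'(\{X,Y\})\in\operatorname{MinEvid}(X\cup Y)$, and $f'(\{X,Y\})$, $g'(\{X,Y\})$ are respectively the infimum and the supremum of $\{X,Y\}$ in $(H,\subseteq)$ (the empty set is accepted as a lattice). A lattice definable below $S$ is defined in the same way with $\operatorname{Evidb}(S)$ in place of $\operatorname{Evido}(S)$. For lattices $L,M$ of this kind, $L\leq_{\mathrm{latt}}M$ means that $L\subseteq M$ as sets and, for every two distinct elements $a,b\in L$, $\inf_L(\{a,b\})=\inf_M(\{a,b\})$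 and $\sup_L(\{a,b\})=\sup_M(\{a,b\})$. $S$ is a cut of over (respectively below) unicity for $A$ if there exists exactly one lattice definable over (respectively below) $S$ that is maximal for $\leq_{\mathrm{latt}}$. *)

theory Defs
  imports Complex_Main "HOL-Library.FuncSet" "HOL-Algebra.Lattice"
begin

locale nonassoc_algebra = vector_space scale
  for scale :: "'k::field \<Rightarrow> 'a::ab_group_add \<Rightarrow> 'a" +
  fixes mult :: "'a \<Rightarrow> 'a \<Rightarrow> 'a"  (infixl \<open>\<bullet>\<close> 70)
  assumes linear_mult_right: "Vector_Spaces.linear scale scale (\<lambda>y. x \<bullet> y)"
    and linear_mult_left: "Vector_Spaces.linear scale scale (\<lambda>x. x \<bullet> y)"
begin

definition algebra_ideal :: "'a set \<Rightarrow> bool"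
  where "algebra_ideal I \<longleftrightarrow> subspace I \<and> (\<forall>a. \<forall>x\<in>I. a \<bullet> x \<in> I \<and> x \<bullet> a \<in> I)"

definition natural_basis :: "'a set \<Rightarrow> 'a set \<Rightarrow> bool"
  where "natural_basis B V \<longleftrightarrow>
    independent B \<and> span B = V \<and> (\<forall>x\<in>B. \<forall>y\<in>B. x \<noteq> y \<longrightarrow> x \<bullet> y = 0)"

definition evolution_ideal :: "'a set \<Rightarrow> bool"
  where "evolution_ideal I \<longleftrightarrow> algebra_ideal I \<and> (\<exists>B. natural_basis B I)"

definition Evido :: "'a set \<Rightarrow> 'a set set"
  where "Evido S = {I. evolution_ideal I \<and> S \<subseteq> I}"

definition Evidb :: "'a set \<Rightarrow> 'a set set"
  where "Evidb S = {I. evolution_ideal I \<and> I \<subseteq> S}"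

definition MinEvid :: "'a set \<Rightarrow> 'a set set"
  where "MinEvid T = {I \<in> Evido T. \<forall>J \<in> Evido T. J \<subseteq> I \<longrightarrow> J = I}"

definition MaxEvid :: "'a set \<Rightarrow> 'a set set"
  where "MaxEvid T = {I \<in> Evidb T. \<forall>J \<in> Evidb T. I \<subseteq> J \<longrightarrow> J = I}"

end

locale evolution_algebra = nonassoc_algebra +
  assumes ex_natural_basis: "\<exists>B. natural_basis B UNIV"

definition inclusion_order :: "'a set set \<Rightarrow> 'a set gorder"
  where "inclusion_order H = \<lparr>carrier = H, eq = (=), le = (\<subseteq>)\<rparr>"

definition two_subsets :: "'b set \<Rightarrow> 'b set set"
  where "two_subsets H = {P. P \<subseteq> H \<and> card P = 2}"

type_synonym 'a lattice_triple =
  "'a set set \<times> ('a set set \<Rightarrow> 'a set) \<times> ('a set set \<Rightarrow> 'a set)"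

text \<open>
  The two maps of a lattice have the two-element subsets of \<open>H\<close> as their domain; they are
  extensional functions, so that two lattices are equal as triples exactly when
  their carriers agree and their maps agree on these subsets.
\<close>

context nonassoc_algebra
begin

fun definable_lattice :: "'a set set \<Rightarrow> 'a lattice_triple \<Rightarrow> bool"
  where "definable_lattice E (H, f, g) \<longleftrightarrow>
    H \<subseteq> E \<and> f \<in> two_subsets H \<rightarrow>\<^sub>E H \<and> g \<in> two_subsets H \<rightarrow>\<^sub>E H \<and>
    (\<forall>X\<in>H. \<forall>Y\<in>H. X \<noteq> Y \<longrightarrow>
      f {X, Y} \<in> MaxEvid (X \<inter> Y) \<and> g {X, Y} \<in> MinEvid (X \<union> Y) \<and>
      greatest (inclusion_order H) (f {X, Y}) (Lower (inclusion_order H) {X, Y}) \<and>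
      least (inclusion_order H) (g {X, Y}) (Upper (inclusion_order H) {X, Y}))"

abbreviation lattice_over :: "'a set \<Rightarrow> 'a lattice_triple \<Rightarrow> bool"
  where "lattice_over S \<equiv> definable_lattice (Evido S)"

abbreviation lattice_below :: "'a set \<Rightarrow> 'a lattice_triple \<Rightarrow> bool"
  where "lattice_below S \<equiv> definable_lattice (Evidb S)"

end

fun le_latt :: "'a lattice_triple \<Rightarrow> 'a lattice_triple \<Rightarrow> bool"  (infix \<open>\<le>\<^sub>l\<^sub>a\<^sub>t\<^sub>t\<close> 50)
  where "(H, f, g) \<le>\<^sub>l\<^sub>a\<^sub>t\<^sub>t (H', f', g') \<longleftrightarrow>
    H \<subseteq> H' \<and>
    (\<forall>X\<in>H. \<forall>Y\<in>H. X \<noteq> Y \<longrightarrow>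
      \<Sqinter>\<^bsub>inclusion_order H\<^esub>{X, Y} = \<Sqinter>\<^bsub>inclusion_order H'\<^esub>{X, Y} \<and>
      \<Squnion>\<^bsub>inclusion_order H\<^esub>{X, Y} = \<Squnion>\<^bsub>inclusion_order H'\<^esub>{X, Y})"

definition maximal_lattice :: "('a lattice_triple \<Rightarrow> bool) \<Rightarrow> 'a lattice_triple \<Rightarrow> bool"
  where "maximal_lattice P L \<longleftrightarrow> P L \<and> (\<forall>M. P M \<and> L \<le>\<^sub>l\<^sub>a\<^sub>t\<^sub>t M \<longrightarrow> M = L)"

context nonassoc_algebra
begin

definition cut_of_over_unicity :: "'a set \<Rightarrow> bool"
  where "cut_of_over_unicity S \<longleftrightarrow> (\<exists>!L. maximal_lattice (lattice_over S) L)"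

definition cut_of_below_unicity :: "'a set \<Rightarrow> bool"
  where "cut_of_below_unicity S \<longleftrightarrow> (\<exists>!L. maximal_lattice (lattice_below S) L)"

end

definition maximal_member :: "'a set set \<Rightarrow> 'a set \<Rightarrow> bool"
  where "maximal_member F R \<longleftrightarrow> R \<in> F \<and> (\<forall>R'\<in>F. R \<subseteq> R' \<longrightarrow> R' = R)"

end

theory Submission
  imports Defs
begin

text \<open>
  Every singleton of an admissible evolution ideal is a lattice, and by Zorn's lemma every
  definable lattice extends to a maximal one. Hence, if the maximal lattice is unique, its carrier
  consists of all the admissible evolution ideals, so the latter have pairwise infima and suprema
  that are members of the corresponding \<open>MaxEvid\<close> and \<open>MinEvid\<close>; by extremality they are the
  only such members. Below \<open>S\<close>, the ideals containing \<open>I \<union> J\<close> are moreover closed under these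
  suprema, so one of maximal dimension is the greatest.
\<close>

section \<open>Infima and suprema of pairs in a family ordered by inclusion\<close>

lemma greatest_Lower_inclusion_iff:
  assumes "X \<in> H" "Y \<in> H"
  shows "greatest (inclusion_order H) Z (Lower (inclusion_order H) {X, Y}) \<longleftrightarrow>
    Z \<in> H \<and> Z \<subseteq> X \<and> Z \<subseteq> Y \<and> (\<forall>W\<in>H. W \<subseteq> X \<longrightarrow> W \<subseteq> Y \<longrightarrow> W \<subseteq> Z)"
proof -
  \<comment> \<open>\<open>Lower\<close> tests only those elements of \<open>{X, Y}\<close> that lie
    in the carrier; the membership hypotheses make it test both.\<close>
  have "Lower (inclusion_order H) {X, Y} = {W \<in> H. W \<subseteq> X \<and> W \<subseteq> Y}"
    using assms by (simp add: Lower_def inclusion_order_def) blast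
  then show ?thesis
    by (simp add: greatest_def inclusion_order_def) blast
qed

lemma least_Upper_inclusion_iff:
  assumes "X \<in> H" "Y \<in> H"
  shows "least (inclusion_order H) Z (Upper (inclusion_order H) {X, Y}) \<longleftrightarrow>
    Z \<in> H \<and> X \<subseteq> Z \<and> Y \<subseteq> Z \<and> (\<forall>W\<in>H. X \<subseteq> W \<longrightarrow> Y \<subseteq> W \<longrightarrow> Z \<subseteq> W)"
proof -
  have "Upper (inclusion_order H) {X, Y} = {W \<in> H. X \<subseteq> W \<and> Y \<subseteq> W}"
    using assms by (simp add: Upper_def inclusion_order_def) blast
  then show ?thesis
    by (simp add: least_def inclusion_order_def) blast
qed

text \<open>The infimum is a Hilbert choice among the greatest lower bounds. Two such bounds contain
  each other, so the choice is forced.\<close>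

lemma inf_inclusion_eq:
  assumes "greatest (inclusion_order H) Z (Lower (inclusion_order H) A)"
  shows "\<Sqinter>\<^bsub>inclusion_order H\<^esub>A = Z"
  unfolding inf_def using assms
  by (rule some_equality) (use assms in \<open>auto simp: greatest_def inclusion_order_def\<close>)

lemma sup_inclusion_eq:
  assumes "least (inclusion_order H) Z (Upper (inclusion_order H) A)"
  shows "\<Squnion>\<^bsub>inclusion_order H\<^esub>A = Z"
  unfolding sup_def using assms
  by (rule some_equality) (use assms in \<open>auto simp: least_def inclusion_order_def\<close>)

lemma two_subsetsE:
  assumes "P \<in> two_subsets H"
  obtains X Y where "P = {X, Y}" "X \<in> H" "Y \<in> H" "X \<noteq> Y"
  using assms by (auto simp: two_subsets_def card_2_iff)

lemma two_subsetsI: "X \<in> H \<Longrightarrow> Y \<in> H \<Longrightarrow> X \<noteq> Y \<Longrightarrow> {X, Y} \<in> two_subsets H"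
  by (auto simp: two_subsets_def)

lemma ball_two_subsets_iff:
  "(\<forall>P\<in>two_subsets H. Q P) \<longleftrightarrow> (\<forall>X\<in>H. \<forall>Y\<in>H. X \<noteq> Y \<longrightarrow> Q {X, Y})"
  by (auto elim!: two_subsetsE intro: two_subsetsI)

lemma two_subsets_mono: "H \<subseteq> H' \<Longrightarrow> two_subsets H \<subseteq> two_subsets H'"
  by (auto simp: two_subsets_def)

lemma two_subsets_singleton: "two_subsets {X} = {}"
  by (auto elim!: two_subsetsE)

text \<open>Both moreover-claims of the theorem end here: a maximal member lies inside the greatest
  one and therefore equals it.\<close>

lemma ex1_maximal_member:
  assumes G: "G \<in> F" and le: "\<And>R. R \<in> F \<Longrightarrow> R \<subseteq> G"
  shows "\<exists>!R. maximal_member F R"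
proof (rule ex1I)
  show "maximal_member F G"
    using G le by (simp add: maximal_member_def subset_antisym)
  show "R = G" if "maximal_member F R" for R
    using that G le[of R] unfolding maximal_member_def by metis
qed

section \<open>Definable lattices and their order\<close>

context nonassoc_algebra
begin

text \<open>Membership in \<open>MaxEvid (X \<inter> Y)\<close> makes \<open>f {X, Y}\<close> a
  lower bound of both ideals, and the type of \<open>f\<close> places it in \<open>H\<close>. Under
  these conditions \<open>greatest\<close> amounts to containing every other lower bound in
  \<open>H\<close>; dually for \<open>g\<close>.\<close>

lemma definable_lattice_iff:
  "definable_lattice E (H, f, g) \<longleftrightarrow>
    H \<subseteq> E \<and> f \<in> two_subsets H \<rightarrow>\<^sub>E H \<and> g \<in> two_subsets H \<rightarrow>\<^sub>E H \<and>
    (\<forall>X\<in>H. \<forall>Y\<in>H. X \<noteq> Y \<longrightarrow>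
      f {X, Y} \<in> MaxEvid (X \<inter> Y) \<and> g {X, Y} \<in> MinEvid (X \<union> Y) \<and>
      (\<forall>W\<in>H. W \<subseteq> X \<longrightarrow> W \<subseteq> Y \<longrightarrow> W \<subseteq> f {X, Y}) \<and>
      (\<forall>W\<in>H. X \<subseteq> W \<longrightarrow> Y \<subseteq> W \<longrightarrow> g {X, Y} \<subseteq> W))"
proof -
  have "f {X, Y} \<in> MaxEvid (X \<inter> Y) \<and> g {X, Y} \<in> MinEvid (X \<union> Y) \<and>
      greatest (inclusion_order H) (f {X, Y}) (Lower (inclusion_order H) {X, Y}) \<and>
      least (inclusion_order H) (g {X, Y}) (Upper (inclusion_order H) {X, Y}) \<longleftrightarrow>
      f {X, Y} \<in> MaxEvid (X \<inter> Y) \<and> g {X, Y} \<in> MinEvid (X \<union> Y) \<and>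
      (\<forall>W\<in>H. W \<subseteq> X \<longrightarrow> W \<subseteq> Y \<longrightarrow> W \<subseteq> f {X, Y}) \<and>
      (\<forall>W\<in>H. X \<subseteq> W \<longrightarrow> Y \<subseteq> W \<longrightarrow> g {X, Y} \<subseteq> W)"
    if "f \<in> two_subsets H \<rightarrow>\<^sub>E H" "g \<in> two_subsets H \<rightarrow>\<^sub>E H" and XY: "X \<in> H" "Y \<in> H" "X \<noteq> Y" for X Y
  proof -
    have "f {X, Y} \<in> H" "g {X, Y} \<in> H"
      using that(1,2) two_subsetsI[OF XY] by (auto dest: PiE_mem)
    moreover have "f {X, Y} \<subseteq> X \<and> f {X, Y} \<subseteq> Y" if "f {X, Y} \<in> MaxEvid (X \<inter> Y)"
      using that by (simp add: MaxEvid_def Evidb_def)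
    moreover have "X \<subseteq> g {X, Y} \<and> Y \<subseteq> g {X, Y}" if "g {X, Y} \<in> MinEvid (X \<union> Y)"
      using that by (simp add: MinEvid_def Evido_def)
    ultimately show ?thesis
      unfolding greatest_Lower_inclusion_iff[OF XY(1,2)] least_Upper_inclusion_iff[OF XY(1,2)]
      by (simp cong: conj_cong)
  qed
  then show ?thesis
    unfolding definable_lattice.simps by (simp cong: conj_cong ball_cong)
qed

lemma definable_latticeD:
  assumes "definable_lattice E (H, f, g)" and XY: "X \<in> H" "Y \<in> H" "X \<noteq> Y"
  shows "f {X, Y} \<in> H" "g {X, Y} \<in> H" "f {X, Y} \<in> MaxEvid (X \<inter> Y)" "g {X, Y} \<in> MinEvid (X \<union> Y)"
    and "W \<in> H \<Longrightarrow> W \<subseteq> X \<Longrightarrow> W \<subseteq> Y \<Longrightarrow> W \<subseteq> f {X, Y}"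
    and "W \<in> H \<Longrightarrow> X \<subseteq> W \<Longrightarrow> Y \<subseteq> W \<Longrightarrow> g {X, Y} \<subseteq> W"
proof -
  have f: "f \<in> two_subsets H \<rightarrow>\<^sub>E H" and g: "g \<in> two_subsets H \<rightarrow>\<^sub>E H"
    and fg: "\<forall>X\<in>H. \<forall>Y\<in>H. X \<noteq> Y \<longrightarrow>
      f {X, Y} \<in> MaxEvid (X \<inter> Y) \<and> g {X, Y} \<in> MinEvid (X \<union> Y) \<and>
      (\<forall>W\<in>H. W \<subseteq> X \<longrightarrow> W \<subseteq> Y \<longrightarrow> W \<subseteq> f {X, Y}) \<and>
      (\<forall>W\<in>H. X \<subseteq> W \<longrightarrow> Y \<subseteq> W \<longrightarrow> g {X, Y} \<subseteq> W)"
    using assms(1) unfolding definable_lattice_iff by iprover+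
  show "f {X, Y} \<in> H" "g {X, Y} \<in> H"
    using PiE_mem[OF f two_subsetsI[OF XY]] PiE_mem[OF g two_subsetsI[OF XY]] .
  from fg[rule_format, OF XY]
  show "f {X, Y} \<in> MaxEvid (X \<inter> Y)" "g {X, Y} \<in> MinEvid (X \<union> Y)"
    and "W \<in> H \<Longrightarrow> W \<subseteq> X \<Longrightarrow> W \<subseteq> Y \<Longrightarrow> W \<subseteq> f {X, Y}"
    and "W \<in> H \<Longrightarrow> X \<subseteq> W \<Longrightarrow> Y \<subseteq> W \<Longrightarrow> g {X, Y} \<subseteq> W"
    by simp_all
qed

lemma definable_lattice_inf:
  assumes "definable_lattice E (H, f, g)" "X \<in> H" "Y \<in> H" "X \<noteq> Y"
  shows "\<Sqinter>\<^bsub>inclusion_order H\<^esub>{X, Y} = f {X, Y}"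
  using assms by (intro inf_inclusion_eq) simp

lemma definable_lattice_sup:
  assumes "definable_lattice E (H, f, g)" "X \<in> H" "Y \<in> H" "X \<noteq> Y"
  shows "\<Squnion>\<^bsub>inclusion_order H\<^esub>{X, Y} = g {X, Y}"
  using assms by (intro sup_inclusion_eq) simp

text \<open>Infima and suprema in the carriers are the values of the maps, so the order is extension
  of carriers and maps. In this form lattices can be glued along a chain.\<close>

lemma le_latt_iff:
  assumes "definable_lattice E (H, f, g)" "definable_lattice E (H', f', g')"
  shows "(H, f, g) \<le>\<^sub>l\<^sub>a\<^sub>t\<^sub>t (H', f', g') \<longleftrightarrow>
    H \<subseteq> H' \<and> (\<forall>P\<in>two_subsets H. f P = f' P \<and> g P = g' P)"
proof -
  have "X \<in> H'" if "H \<subseteq> H'" "X \<in> H" for X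
    using that by auto
  then show ?thesis
    by (cases "H \<subseteq> H'") (simp_all add: ball_two_subsets_iff
      definable_lattice_inf[OF assms(1)] definable_lattice_inf[OF assms(2)]
      definable_lattice_sup[OF assms(1)] definable_lattice_sup[OF assms(2)] cong: ball_cong)
qed

lemma le_latt_refl: "L \<le>\<^sub>l\<^sub>a\<^sub>t\<^sub>t L"
  by (cases L) simp

lemma le_latt_trans:
  assumes "L \<le>\<^sub>l\<^sub>a\<^sub>t\<^sub>t M" "M \<le>\<^sub>l\<^sub>a\<^sub>t\<^sub>t N"
  shows "L \<le>\<^sub>l\<^sub>a\<^sub>t\<^sub>t N"
  using assms by (cases L; cases M; cases N) (auto simp: subset_iff)

text \<open>The inclusions give equal carriers. The maps then agree on the two-element subsets and,
  being extensional, are both \<open>undefined\<close> elsewhere.\<close>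

lemma le_latt_antisym:
  assumes "definable_lattice E L" "definable_lattice E M" "L \<le>\<^sub>l\<^sub>a\<^sub>t\<^sub>t M" "M \<le>\<^sub>l\<^sub>a\<^sub>t\<^sub>t L"
  shows "L = M"
proof -
  obtain H f g H' f' g' where eq: "L = (H, f, g)" "M = (H', f', g')"
    by (cases L; cases M) auto
  have H: "H' = H"
    using assms(3,4) unfolding eq le_latt.simps by (elim conjE) (rule subset_antisym)
  have agree: "\<forall>P\<in>two_subsets H. f P = f' P \<and> g P = g' P"
    using assms(3) unfolding eq le_latt_iff[OF assms(1,2)[unfolded eq]] by (rule conjunct2)
  have f: "f \<in> two_subsets H \<rightarrow>\<^sub>E H" "f' \<in> two_subsets H \<rightarrow>\<^sub>E H"
    and g: "g \<in> two_subsets H \<rightarrow>\<^sub>E H" "g' \<in> two_subsets H \<rightarrow>\<^sub>E H"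
    using assms(1,2) unfolding eq H definable_lattice_iff by iprover+
  have "f = f'" "g = g'"
    using PiE_ext[OF f] PiE_ext[OF g] agree by simp_all
  then show ?thesis
    by (simp add: eq H)
qed

section \<open>Extension to maximal lattices by Zorn's lemma\<close>

lemma definable_lattice_singleton:
  "X \<in> E \<Longrightarrow> definable_lattice E ({X}, \<lambda>_. undefined, \<lambda>_. undefined)"
  \<comment> \<open>A singleton has no two-element subset, so the extensional maps are constantly
    \<open>undefined\<close> and the conditions on pairs are vacuous.\<close>
  by (auto simp: two_subsets_singleton)

text \<open>The bound is the union of the carriers with the maps glued together. Each condition on
  pairs involves at most three elements of the carrier, and these lie in a single member of the
  chain. \<open>MaxEvid\<close> and \<open>MinEvid\<close> do not depend on the carrier, so
  membership in them carries over.\<close>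

lemma definable_lattice_chain_upper_bound:
  assumes "C \<noteq> {}" and lat: "\<And>M. M \<in> C \<Longrightarrow> definable_lattice E M"
    and chain: "\<And>M N. M \<in> C \<Longrightarrow> N \<in> C \<Longrightarrow> M \<le>\<^sub>l\<^sub>a\<^sub>t\<^sub>t N \<or> N \<le>\<^sub>l\<^sub>a\<^sub>t\<^sub>t M"
  obtains U where "definable_lattice E U" "\<And>M. M \<in> C \<Longrightarrow> M \<le>\<^sub>l\<^sub>a\<^sub>t\<^sub>t U"
proof -
  define K where "K = (\<Union>M\<in>C. fst M)"
  \<comment> \<open>\<open>c P\<close> is an arbitrary member of the chain whose carrier includes
    \<open>P\<close>. By comparability, any two such members give \<open>P\<close> the same values
    (\<open>agree\<close>), so the glued maps do not depend on the choice.\<close>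
  define c where "c P = (SOME M. M \<in> C \<and> P \<in> two_subsets (fst M))" for P
  define f where "f = restrict (\<lambda>P. fst (snd (c P)) P) (two_subsets K)"
  define g where "g = restrict (\<lambda>P. snd (snd (c P)) P) (two_subsets K)"
  have agree: "f\<^sub>1 P = f\<^sub>2 P \<and> g\<^sub>1 P = g\<^sub>2 P"
    if "(H\<^sub>1, f\<^sub>1, g\<^sub>1) \<in> C" "(H\<^sub>2, f\<^sub>2, g\<^sub>2) \<in> C" "P \<in> two_subsets H\<^sub>1" "P \<in> two_subsets H\<^sub>2"
    for H\<^sub>1 f\<^sub>1 g\<^sub>1 H\<^sub>2 f\<^sub>2 g\<^sub>2 P
    using chain[OF that(1,2)] that(3,4)
    unfolding le_latt_iff[OF lat[OF that(1)] lat[OF that(2)]]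
      le_latt_iff[OF lat[OF that(2)] lat[OF that(1)]] by (elim disjE) simp_all
  have sub: "H \<subseteq> K" if "(H, f', g') \<in> C" for H f' g'
    using that by (force simp: K_def)
  have fg: "f P = f' P" "g P = g' P" if M: "(H, f', g') \<in> C" and P: "P \<in> two_subsets H" for H f' g' P
  proof -
    have "c P \<in> C \<and> P \<in> two_subsets (fst (c P))"
      unfolding c_def by (rule someI[of _ "(H, f', g')"]) (use M P in simp)
    then have "fst (snd (c P)) P = f' P \<and> snd (snd (c P)) P = g' P"
      using agree[OF _ M _ P, of "fst (c P)" "fst (snd (c P))" "snd (snd (c P))"] by simp
    moreover have "P \<in> two_subsets K"
      using P two_subsets_mono[OF sub[OF M]] by blast
    ultimately show "f P = f' P" "g P = g' P"
      by (simp_all add: f_def g_def)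
  qed
  \<comment> \<open>Carriers of comparable lattices are nested, so induction finds one carrier
    around any finite part of \<open>K\<close>. For the empty set any member of the nonempty
    \<open>C\<close> will do.\<close>
  have common: "\<exists>H f' g'. (H, f', g') \<in> C \<and> A \<subseteq> H" if "finite A" "A \<subseteq> K" for A
    using that
  proof (induction A)
    case empty
    then show ?case using assms(1) by auto
  next
    case (insert X A)
    then obtain H f' g' where H: "(H, f', g') \<in> C" "A \<subseteq> H" by auto
    obtain H' f'' g'' where H': "(H', f'', g'') \<in> C" "X \<in> H'"
      using insert.prems by (auto simp: K_def)
    have "H \<subseteq> H' \<or> H' \<subseteq> H"
      using chain[OF H(1) H'(1)] by auto
    with H H' show ?case by blast
  qed
  have mem: "f P \<in> K" "g P \<in> K" if "P \<in> two_subsets K" for P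
  proof -
    obtain X Y where P: "P = {X, Y}" "X \<in> K" "Y \<in> K" "X \<noteq> Y"
      using \<open>P \<in> two_subsets K\<close> by (rule two_subsetsE)
    then obtain H f' g' where H: "(H, f', g') \<in> C" "{X, Y} \<subseteq> H"
      using common[of "{X, Y}"] by auto
    then have PH: "P \<in> two_subsets H"
      using P by (auto intro: two_subsetsI)
    have "f' P \<in> H" "g' P \<in> H"
      using definable_latticeD(1,2)[OF lat[OF H(1)], of X Y] H(2) P by auto
    then show "f P \<in> K" "g P \<in> K"
      using fg[OF H(1) PH] sub[OF H(1)] by auto
  qed
  have K: "definable_lattice E (K, f, g)"
    unfolding definable_lattice_iff
  proof (intro conjI ballI impI)
    show "K \<subseteq> E"
      using lat by (force simp: K_def)
    show "f \<in> two_subsets K \<rightarrow>\<^sub>E K" "g \<in> two_subsets K \<rightarrow>\<^sub>E K"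
      using mem by (auto simp: f_def g_def)
  next
    fix X Y assume XY: "X \<in> K" "Y \<in> K" "X \<noteq> Y"
    obtain H f' g' where H: "(H, f', g') \<in> C" "{X, Y} \<subseteq> H"
      using common[of "{X, Y}"] XY by auto
    show "f {X, Y} \<in> MaxEvid (X \<inter> Y)" "g {X, Y} \<in> MinEvid (X \<union> Y)"
      using definable_latticeD(3,4)[OF lat[OF H(1)], of X Y] fg[OF H(1)] H(2) XY
        two_subsetsI[of X H Y] by auto
  next
    \<comment> \<open>The test ideal \<open>W\<close> has to share a carrier with \<open>X\<close>
      and \<open>Y\<close> before the extremal property in that member can be applied to it.\<close>
    fix X Y W assume XY: "X \<in> K" "Y \<in> K" "X \<noteq> Y" and W: "W \<in> K"
    obtain H f' g' where H: "(H, f', g') \<in> C" "{X, Y, W} \<subseteq> H"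
      using common[of "{X, Y, W}"] XY W by auto
    show "W \<subseteq> f {X, Y}" if "W \<subseteq> X" "W \<subseteq> Y"
      using definable_latticeD(5)[OF lat[OF H(1)], of X Y W] fg[OF H(1)] H(2) XY
        two_subsetsI[of X H Y] that by auto
    show "g {X, Y} \<subseteq> W" if "X \<subseteq> W" "Y \<subseteq> W"
      using definable_latticeD(6)[OF lat[OF H(1)], of X Y W] fg[OF H(1)] H(2) XY
        two_subsetsI[of X H Y] that by auto
  qed
  moreover have "M \<le>\<^sub>l\<^sub>a\<^sub>t\<^sub>t (K, f, g)" if "M \<in> C" for M
  proof (cases M)
    case (fields H f' g')
    then have M: "(H, f', g') \<in> C"
      using that by simp
    then show ?thesis
      unfolding fields le_latt_iff[OF lat[OF M] K] using sub[OF M] fg[OF M] by simp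
  qed
  ultimately show thesis
    by (rule that)
qed

text \<open>Zorn's lemma is applied only to the definable lattices above \<open>L\<close>, so that
  the maximal element obtained extends \<open>L\<close>.\<close>

lemma ex_maximal_lattice_extension:
  assumes L: "definable_lattice E L"
  obtains M where "maximal_lattice (definable_lattice E) M" "L \<le>\<^sub>l\<^sub>a\<^sub>t\<^sub>t M"
proof -
  let ?A = "{M. definable_lattice E M \<and> L \<le>\<^sub>l\<^sub>a\<^sub>t\<^sub>t M}"
  have "partial_order_on ?A (relation_of (\<le>\<^sub>l\<^sub>a\<^sub>t\<^sub>t) ?A)"
  proof (rule partial_order_on_relation_ofI)
    show "M \<le>\<^sub>l\<^sub>a\<^sub>t\<^sub>t M" for M
      by (rule le_latt_refl)
    show "M \<le>\<^sub>l\<^sub>a\<^sub>t\<^sub>t K" if "M \<le>\<^sub>l\<^sub>a\<^sub>t\<^sub>t N" "N \<le>\<^sub>l\<^sub>a\<^sub>t\<^sub>t K" for M N K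
      using that by (rule le_latt_trans)
    show "M = N" if "M \<in> ?A" "N \<in> ?A" "M \<le>\<^sub>l\<^sub>a\<^sub>t\<^sub>t N" "N \<le>\<^sub>l\<^sub>a\<^sub>t\<^sub>t M" for M N
      using that le_latt_antisym[of E M N] by simp
  qed
  moreover have "\<exists>U\<in>?A. \<forall>M\<in>C. M \<le>\<^sub>l\<^sub>a\<^sub>t\<^sub>t U" if "C \<in> Chains (relation_of (\<le>\<^sub>l\<^sub>a\<^sub>t\<^sub>t) ?A)" for C
  proof (cases "C = {}")
    case True
    \<comment> \<open>The empty chain needs a bound inside \<open>?A\<close>, and \<open>L\<close>
      itself is one.\<close>
    show ?thesis
      by (rule bexI[of _ L]) (simp_all only: True L le_latt_refl mem_Collect_eq ball_empty simp_thms)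
  next
    case False
    have C: "C \<subseteq> ?A"
      using that unfolding Chains_def relation_of_def by blast
    have chain: "M \<le>\<^sub>l\<^sub>a\<^sub>t\<^sub>t N \<or> N \<le>\<^sub>l\<^sub>a\<^sub>t\<^sub>t M" if "M \<in> C" "N \<in> C" for M N
      using \<open>C \<in> Chains _\<close> that unfolding Chains_def relation_of_def by blast
    have lat: "definable_lattice E M" if "M \<in> C" for M
      using C that by blast
    obtain U where U: "definable_lattice E U" "\<And>M. M \<in> C \<Longrightarrow> M \<le>\<^sub>l\<^sub>a\<^sub>t\<^sub>t U"
      using definable_lattice_chain_upper_bound[OF False lat chain] by blast
    obtain M where M: "M \<in> C"
      using False by blast
    then have "L \<le>\<^sub>l\<^sub>a\<^sub>t\<^sub>t U"
      using le_latt_trans[OF _ U(2)[OF M]] C by blast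
    with U(1) have "U \<in> ?A"
      by simp
    with U(2) show ?thesis
      by (intro bexI[of _ U] ballI)
  qed
  ultimately have "\<exists>M\<in>?A. \<forall>N\<in>?A. M \<le>\<^sub>l\<^sub>a\<^sub>t\<^sub>t N \<longrightarrow> N = M"
    by (rule predicate_Zorn)
  then obtain M where M: "definable_lattice E M" "L \<le>\<^sub>l\<^sub>a\<^sub>t\<^sub>t M"
    and max: "\<forall>N\<in>?A. M \<le>\<^sub>l\<^sub>a\<^sub>t\<^sub>t N \<longrightarrow> N = M"
    by (elim bexE CollectE conjE)
  \<comment> \<open>Maximality above \<open>L\<close> is maximality among all definable lattices,
    since anything above \<open>M\<close> is above \<open>L\<close>.\<close>
  have "N = M" if "definable_lattice E N" "M \<le>\<^sub>l\<^sub>a\<^sub>t\<^sub>t N" for N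
    using max that le_latt_trans[OF M(2) that(2)] by blast
  with M have "maximal_lattice (definable_lattice E) M" "L \<le>\<^sub>l\<^sub>a\<^sub>t\<^sub>t M"
    unfolding maximal_lattice_def by blast+
  then show thesis
    by (rule that)
qed

text \<open>For each \<open>X\<close> in \<open>E\<close>, a maximal extension of the singleton
  lattice on \<open>X\<close> must be the unique maximal lattice, whose carrier thus contains
  \<open>X\<close>. Hence that carrier is all of \<open>E\<close>.\<close>

lemma definable_lattice_if_unique_maximal:
  assumes "\<exists>!L. maximal_lattice (definable_lattice E) L"
  obtains f g where "definable_lattice E (E, f, g)"
proof -
  obtain H f g where L: "maximal_lattice (definable_lattice E) (H, f, g)"
    using assms by (metis surj_pair)
  then have H: "definable_lattice E (H, f, g)"
    by (simp only: maximal_lattice_def)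
  have "X \<in> H" if X: "X \<in> E" for X
  proof -
    obtain M where "maximal_lattice (definable_lattice E) M"
      "({X}, \<lambda>_. undefined, \<lambda>_. undefined) \<le>\<^sub>l\<^sub>a\<^sub>t\<^sub>t M"
      using ex_maximal_lattice_extension[OF definable_lattice_singleton[OF X]] by blast
    then show ?thesis
      using assms L by (metis insert_subset le_latt.simps)
  qed
  then have "H = E"
    using H by auto
  then show thesis
    using H that by blast
qed

section \<open>Consequences of unicity for ideals above or below the cut\<close>

lemma evolution_ideal_subspace: "evolution_ideal I \<Longrightarrow> subspace I"
  by (simp add: evolution_ideal_def algebra_ideal_def)

text \<open>A member \<open>T\<close> of \<open>MinEvid (I \<union> J)\<close> contains
  \<open>S\<close> through \<open>I\<close>, so it is an upper bound in the full lattice on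
  \<open>Evido S\<close> and contains the supremum. Minimality of \<open>T\<close> then forces
  equality.\<close>

lemma cut_of_over_unicity_MinEvid:
  assumes "cut_of_over_unicity S" "I \<in> Evido S" "J \<in> Evido S" "I \<noteq> J"
  shows "\<exists>!T. evolution_ideal T \<and> T \<in> MinEvid (I \<union> J)"
proof -
  obtain f g where fg: "definable_lattice (Evido S) (Evido S, f, g)"
    using assms(1) definable_lattice_if_unique_maximal unfolding cut_of_over_unicity_def by blast
  have g: "g {I, J} \<in> MinEvid (I \<union> J)"
    and le: "\<And>W. W \<in> Evido S \<Longrightarrow> I \<subseteq> W \<Longrightarrow> J \<subseteq> W \<Longrightarrow> g {I, J} \<subseteq> W"
    using definable_latticeD[OF fg assms(2-)] by blast+
  show ?thesis
  proof (rule ex1I[of _ "g {I, J}"])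
    show "evolution_ideal (g {I, J}) \<and> g {I, J} \<in> MinEvid (I \<union> J)"
      using g by (simp add: MinEvid_def Evido_def)
    fix T assume T: "evolution_ideal T \<and> T \<in> MinEvid (I \<union> J)"
    then have "g {I, J} \<subseteq> T"
      using assms(2) by (intro le) (auto simp: MinEvid_def Evido_def)
    with T g show "T = g {I, J}"
      by (auto simp: MinEvid_def)
  qed
qed

text \<open>The family consists of the lower bounds of \<open>I\<close> and \<open>J\<close> in
  \<open>Evido S\<close>, so the infimum is its greatest member.\<close>

lemma cut_of_over_unicity_maximal_member:
  assumes "cut_of_over_unicity S" "I \<in> Evido S" "J \<in> Evido S" "I \<noteq> J"
  shows "\<exists>!R. maximal_member {R. evolution_ideal R \<and> S \<subseteq> R \<and> R \<subseteq> I \<inter> J} R"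
proof -
  let ?F = "{R. evolution_ideal R \<and> S \<subseteq> R \<and> R \<subseteq> I \<inter> J}"
  obtain f g where fg: "definable_lattice (Evido S) (Evido S, f, g)"
    using assms(1) definable_lattice_if_unique_maximal unfolding cut_of_over_unicity_def by blast
  have "f {I, J} \<in> Evido S" "f {I, J} \<in> MaxEvid (I \<inter> J)"
    and le: "\<And>W. W \<in> Evido S \<Longrightarrow> W \<subseteq> I \<Longrightarrow> W \<subseteq> J \<Longrightarrow> W \<subseteq> f {I, J}"
    using definable_latticeD[OF fg assms(2-)] by blast+
  then have "f {I, J} \<in> ?F"
    by (auto simp: MaxEvid_def Evidb_def Evido_def)
  moreover have "\<And>R. R \<in> ?F \<Longrightarrow> R \<subseteq> f {I, J}"
    by (rule le) (auto simp: Evido_def)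
  ultimately show ?thesis
    by (rule ex1_maximal_member)
qed

text \<open>Dual argument: \<open>T\<close> lies in \<open>S\<close> through \<open>I\<close>, hence
  below the infimum in \<open>Evidb S\<close>, and maximality of \<open>T\<close> gives
  equality.\<close>

lemma cut_of_below_unicity_MaxEvid:
  assumes "cut_of_below_unicity S" "I \<in> Evidb S" "J \<in> Evidb S" "I \<noteq> J"
  shows "\<exists>!T. evolution_ideal T \<and> T \<in> MaxEvid (I \<inter> J)"
proof -
  obtain f g where fg: "definable_lattice (Evidb S) (Evidb S, f, g)"
    using assms(1) definable_lattice_if_unique_maximal unfolding cut_of_below_unicity_def by blast
  have f: "f {I, J} \<in> MaxEvid (I \<inter> J)"
    and le: "\<And>W. W \<in> Evidb S \<Longrightarrow> W \<subseteq> I \<Longrightarrow> W \<subseteq> J \<Longrightarrow> W \<subseteq> f {I, J}"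
    using definable_latticeD[OF fg assms(2-)] by blast+
  show ?thesis
  proof (rule ex1I[of _ "f {I, J}"])
    show "evolution_ideal (f {I, J}) \<and> f {I, J} \<in> MaxEvid (I \<inter> J)"
      using f by (simp add: MaxEvid_def Evidb_def)
    fix T assume T: "evolution_ideal T \<and> T \<in> MaxEvid (I \<inter> J)"
    then have "T \<subseteq> f {I, J}"
      using assms(2) by (intro le) (auto simp: MaxEvid_def Evidb_def)
    with T f show "T = f {I, J}"
      by (auto simp: MaxEvid_def)
  qed
qed

text \<open>The supremum in the full lattice on \<open>Evidb S\<close> is a common upper bound that
  stays inside \<open>S\<close>. Equal ideals are treated apart because the lattice maps act on
  two-element sets.\<close>

lemma cut_of_below_unicity_directed:
  assumes "cut_of_below_unicity S" "I \<in> Evidb S" "J \<in> Evidb S"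
  obtains T where "T \<in> Evidb S" "I \<union> J \<subseteq> T"
proof (cases "I = J")
  case True
  then show thesis using that assms(2) by blast
next
  case False
  obtain f g where fg: "definable_lattice (Evidb S) (Evidb S, f, g)"
    using assms(1) definable_lattice_if_unique_maximal unfolding cut_of_below_unicity_def by blast
  have "g {I, J} \<in> Evidb S" "g {I, J} \<in> MinEvid (I \<union> J)"
    using definable_latticeD[OF fg assms(2,3) False] by blast+
  then show thesis
    using that by (auto simp: MinEvid_def Evido_def)
qed

end

section \<open>Greatest ideals below the cut, from finite dimension\<close>

lemma (in finite_dimensional_vector_space) ex_maximal_member_subspaces:
  assumes "F \<noteq> {}" "\<And>R. R \<in> F \<Longrightarrow> subspace R"
  obtains R where "maximal_member F R"
proof -
  have "\<forall>R. R \<in> F \<longrightarrow> dim R < Suc dimension"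
    using dim_subset_UNIV by (simp add: less_Suc_eq_le)
  with assms(1) have "\<exists>R. R \<in> F \<and> (\<forall>R'. R' \<in> F \<longrightarrow> dim R' \<le> dim R)"
    by (auto intro: ex_has_greatest_nat)
  then obtain R where R: "R \<in> F" "\<And>R'. R' \<in> F \<Longrightarrow> dim R' \<le> dim R"
    by blast
  \<comment> \<open>\<open>R'\<close> contains \<open>R\<close> and its dimension is no larger, so
    the two subspaces coincide.\<close>
  have "R' = R" if "R' \<in> F" "R \<subseteq> R'" for R'
    using subspace_dim_equal[OF assms(2)[OF R(1)] assms(2)[OF that(1)] that(2) R(2)[OF that(1)]]
    by (rule sym)
  with R(1) have "maximal_member F R"
    by (simp add: maximal_member_def)
  then show thesis
    by (rule that)
qed

text \<open>Finite dimension supplies a maximal member \<open>M\<close>. For any other member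
  \<open>N\<close>, directedness yields \<open>T\<close> in \<open>Evidb S\<close> above
  \<open>N\<close> and \<open>M\<close>. It contains \<open>K\<close> through \<open>N\<close>, so
  it belongs to the family and equals \<open>M\<close>. Thus \<open>M\<close> is the greatest
  member.\<close>

lemma (in nonassoc_algebra) cut_of_below_unicity_maximal_member:
  assumes "finite_dimensional_vector_space scale Basis"
    and cut: "cut_of_below_unicity S" and R: "R \<in> Evidb S" "K \<subseteq> R"
  shows "\<exists>!R. maximal_member {R. evolution_ideal R \<and> R \<subseteq> S \<and> K \<subseteq> R} R"
proof -
  interpret fd: finite_dimensional_vector_space scale Basis
    by (rule assms(1))
  let ?F = "{R. evolution_ideal R \<and> R \<subseteq> S \<and> K \<subseteq> R}"
  have "?F \<noteq> {}"
    using R by (auto simp: Evidb_def)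
  then obtain M where M: "maximal_member ?F M"
    by (rule fd.ex_maximal_member_subspaces) (auto intro: evolution_ideal_subspace)
  show ?thesis
  proof (rule ex1_maximal_member)
    show "M \<in> ?F"
      using M by (simp add: maximal_member_def)
    show "N \<subseteq> M" if N: "N \<in> ?F" for N
    proof -
      obtain T where T: "T \<in> Evidb S" "N \<union> M \<subseteq> T"
        using cut_of_below_unicity_directed[OF cut, of N M] N \<open>M \<in> ?F\<close> by (auto simp: Evidb_def)
      then have "T \<in> ?F" "M \<subseteq> T"
        using N by (auto simp: Evidb_def)
      then have "T = M"
        using M by (simp add: maximal_member_def)
      with T show ?thesis
        by simp
    qed
  qed
qed

theorem theorem35:
  fixes scale :: "'k::field \<Rightarrow> 'a::ab_group_add \<Rightarrow> 'a"
    and mult :: "'a \<Rightarrow> 'a \<Rightarrow> 'a"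
    and S :: "'a set"
  assumes "evolution_algebra scale mult"
    and "\<exists>Basis. finite_dimensional_vector_space scale Basis"
  defines "evid \<equiv> nonassoc_algebra.evolution_ideal scale mult"
  shows
    "(nonassoc_algebra.cut_of_over_unicity scale mult S \<longrightarrow>
       (\<forall>I J. evid I \<and> evid J \<and> I \<noteq> J \<and> S \<subseteq> I \<and> S \<subseteq> J \<and>
           (\<exists>R. evid R \<and> S \<subseteq> R \<and> R \<subseteq> I \<inter> J) \<longrightarrow>
         (\<exists>!T. evid T \<and> T \<in> nonassoc_algebra.MinEvid scale mult (I \<union> J)) \<and>
         (\<exists>!R. maximal_member {R. evid R \<and> S \<subseteq> R \<and> R \<subseteq> I \<inter> J} R))) \<and>
     (nonassoc_algebra.cut_of_below_unicity scale mult S \<longrightarrow>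
       (\<forall>I J. evid I \<and> evid J \<and> I \<noteq> J \<and> I \<subseteq> S \<and> J \<subseteq> S \<and>
           (\<exists>R. evid R \<and> R \<subseteq> S \<and> I \<union> J \<subseteq> R) \<longrightarrow>
         (\<exists>!T. evid T \<and> T \<in> nonassoc_algebra.MaxEvid scale mult (I \<inter> J)) \<and>
         (\<exists>!R. maximal_member {R. evid R \<and> R \<subseteq> S \<and> I \<union> J \<subseteq> R} R)))"
proof -
  interpret evolution_algebra scale mult
    by (rule assms(1))
  obtain Basis where fin: "finite_dimensional_vector_space scale Basis"
    using assms(2) by blast
  show ?thesis
    unfolding evid_def
  proof (intro conjI impI allI; elim conjE exE)
    fix I J
    assume cut: "cut_of_over_unicity S" and "evolution_ideal I" "evolution_ideal J" "I \<noteq> J"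
      "S \<subseteq> I" "S \<subseteq> J"
    then have IJ: "I \<in> Evido S" "J \<in> Evido S" "I \<noteq> J"
      by (simp_all add: Evido_def)
    show "\<exists>!T. evolution_ideal T \<and> T \<in> MinEvid (I \<union> J)"
      using cut IJ by (rule cut_of_over_unicity_MinEvid)
    show "\<exists>!R. maximal_member {R. evolution_ideal R \<and> S \<subseteq> R \<and> R \<subseteq> I \<inter> J} R"
      using cut IJ by (rule cut_of_over_unicity_maximal_member)
  next
    fix I J R
    assume cut: "cut_of_below_unicity S" and "evolution_ideal I" "evolution_ideal J" "I \<noteq> J"
      "I \<subseteq> S" "J \<subseteq> S" and R: "evolution_ideal R" "R \<subseteq> S" "I \<union> J \<subseteq> R"
    then have IJ: "I \<in> Evidb S" "J \<in> Evidb S" "I \<noteq> J"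
      by (simp_all add: Evidb_def)
    show "\<exists>!T. evolution_ideal T \<and> T \<in> MaxEvid (I \<inter> J)"
      using cut IJ by (rule cut_of_below_unicity_MaxEvid)
    show "\<exists>!R. maximal_member {R. evolution_ideal R \<and> R \<subseteq> S \<and> I \<union> J \<subseteq> R} R"
      \<comment> \<open>The given \<open>R\<close> witnesses that the family is nonempty, which is
        where the dimension argument starts.\<close>
      using R by (intro cut_of_below_unicity_maximal_member[OF fin cut, of R])
        (simp_all add: Evidb_def)
  qed
qed

end
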